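(* Let $(\mu,P)$ be a time-homogeneous Markov chain on a countable state space $S$ (with $\sigma$-algebra $2^S$), and let $(A_1,B_1),\dots,(A_k,B_k)$ with $A_i,B_i\subseteq S$ be a Streett acceptance condition such that $$\mathsf P_\mu\Big(\bigcap_{i=1}^k\mathrm{Fin}(A_i)\cup\mathrm{Inf}(B_i)\Big)=p$$ for some $p\in(0,1]$. Then for every $\varepsilon>0$ there exist: - $I\subseteq S$; - $V_0:S\to\mathbb R_{\ge0}$ with $\mu V_0\le1-p+\varepsilon$; - $J_i\subseteq I\setminus A_i$; - $V_i,W_i:S\to\mathbb R_{\ge0}$; - $U_i:S\to\mathbb N$ ($i=1,\dots,k$); such that, for every $i=1,\dots,k$: 1. $\forall s\notin A_i$: $PV_i(s)\le V_i(s)$; 2. $\forall s\in A_i$: $V_i(s)\ge1$; 3. $\exists\gamma_i>0\ \forall s\in J_i$: $V_i(s)\le1-\gamma_i$; 4. $\forall s\in I\setminus(B_i\cup J_i)$: $PW_i(s)\le W_i(s)$ and $W_i(s)>0$; 5. $\forall s\in I\cap(B_i\cup J_i)$: $W_i(s)=U_i(s)=0$; 6. $\forall r\in\mathbb R_{\ge0}\ \exists\varepsilon_r>0\ \forall s\in I\setminus(B_i\cup J_i)$: if $W_i(s)\le r$ then $P(s,\{s':U_i(s')<U_i(s)\})\ge\varepsilon_r$; 7. $\forall r\in\mathbb R_{\ge0}$: $U_i[\{s\in I:W_i(s)\le r\}]$ is a bounded subset of $\mathbb N$; and moreover $\forall s\in I$: $PV_0(s)\le V_0(s)$, and $\forall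 s\notin I$: $V_0(s)\ge1$.
   Context: Setting. - $\mathsf P_\mu$ is the law on $S^\omega$ of the time-homogeneous Markov chain $(\Phi_n)$ with initial distribution $\mu$ and transition kernel $P$. - $\mathrm{Fin}(A)=\bigcup_{n}\bigcap_{m\ge n}\{\Phi_m\notin A\}$ and $\mathrm{Inf}(A)=\bigcap_n\bigcup_{m\ge n}\{\Phi_m\in A\}$. Notation. - $PV(s)=\sum_u V(u)P(s,\{u\})$ and $\mu V=\sum_s V(s)\mu(\{s\})$. - $U_i[X]$ is the image of $X$ under $U_i$. *)

theory Defs
  imports "HOL-Probability.Probability"
begin

text \<open>
  The state space is a countable type \<open>'s\<close> with the discrete sigma-algebra, so that probability
  measures on it are exactly the values of \<open>'s pmf\<close>; \<open>P s\<close> is the distribution \<open>P(s, \<cdot>)\<close>.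
\<close>

text \<open>Conditional law of the state at time \<open>n\<close> given the states \<open>\<omega> j\<close> at the times \<open>j < n\<close>.\<close>

definition markov_step :: "'s pmf \<Rightarrow> ('s \<Rightarrow> 's pmf) \<Rightarrow> nat \<Rightarrow> (nat \<Rightarrow> 's) \<Rightarrow> 's measure" where
  "markov_step \<mu> P n \<omega> = measure_pmf (case n of 0 \<Rightarrow> \<mu> | Suc m \<Rightarrow> P (\<omega> m))"

text \<open>
  The law of the chain is the Ionescu-Tulcea measure of these conditional laws, on the product
  sigma-algebra of \<open>nat \<Rightarrow> 's\<close>; the random variable \<open>\<Phi>\<^sub>n\<close> is the projection \<open>\<lambda>\<omega>. \<omega> n\<close>.
  It is characterised by \<open>sets_markov_law\<close> and \<open>emeasure_markov_law_cylinder\<close> below.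
\<close>

definition markov_law :: "'s pmf \<Rightarrow> ('s \<Rightarrow> 's pmf) \<Rightarrow> (nat \<Rightarrow> 's) measure" where
  "markov_law \<mu> P =
     projective_family.lim UNIV
       (Ionescu_Tulcea.CI (markov_step \<mu> P) (\<lambda>_. count_space UNIV)) (\<lambda>_. count_space UNIV)"

definition Fin_visits :: "'s set \<Rightarrow> (nat \<Rightarrow> 's) set" where
  "Fin_visits A = (\<Union>n. \<Inter>m\<in>{n..}. {\<omega>. \<omega> m \<notin> A})"

definition Inf_visits :: "'s set \<Rightarrow> (nat \<Rightarrow> 's) set" where
  "Inf_visits A = (\<Inter>n. \<Union>m\<in>{n..}. {\<omega>. \<omega> m \<in> A})"

text \<open>
  \<open>pmf_apply (P s) V\<close> is \<open>PV(s)\<close> and \<open>pmf_apply \<mu> V\<close> is \<open>\<mu>V\<close>, for nonnegative \<open>V\<close>. The sum is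
  taken in the extended nonnegative reals, since it may diverge.
\<close>

definition pmf_apply :: "'s pmf \<Rightarrow> ('s \<Rightarrow> real) \<Rightarrow> ennreal" where
  "pmf_apply q V = (\<Sum>\<^sub>\<infinity>u. ennreal (V u) * ennreal (pmf q u))"

lemma pmf_apply_eq_nn_integral:
  fixes q :: "'s :: countable pmf"
  shows "pmf_apply q V = (\<integral>\<^sup>+u. ennreal (V u) \<partial>measure_pmf q)"
proof -
  have "pmf_apply q V = (SUP F\<in>{F. finite F}. \<Sum>u\<in>F. ennreal (V u) * ennreal (pmf q u))"
    unfolding pmf_apply_def by (subst nonneg_infsum_complete) auto
  also have "\<dots> = (\<integral>\<^sup>+u. ennreal (V u) * ennreal (pmf q u) \<partial>count_space UNIV)"
  proof (rule antisym)
    show "(SUP F\<in>{F. finite F}. \<Sum>u\<in>F. ennreal (V u) * ennreal (pmf q u))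
        \<le> (\<integral>\<^sup>+u. ennreal (V u) * ennreal (pmf q u) \<partial>count_space UNIV)"
    proof (rule SUP_least)
      fix F :: "'s set" assume "F \<in> {F. finite F}"
      then have "(\<Sum>u\<in>F. ennreal (V u) * ennreal (pmf q u))
          = (\<integral>\<^sup>+u. ennreal (V u) * ennreal (pmf q u) \<partial>count_space F)"
        by (simp add: nn_integral_count_space_finite)
      also have "\<dots> \<le> (\<integral>\<^sup>+u. ennreal (V u) * ennreal (pmf q u) \<partial>count_space UNIV)"
        by (subst nn_integral_count_space_indicator)
           (auto intro!: nn_integral_mono split: split_indicator)
      finally show "(\<Sum>u\<in>F. ennreal (V u) * ennreal (pmf q u))
          \<le> (\<integral>\<^sup>+u. ennreal (V u) * ennreal (pmf q u) \<partial>count_space UNIV)" .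
    qed
    let ?f = "\<lambda>u. ennreal (V u) * ennreal (pmf q u)" and ?F = "\<lambda>n. {u :: 's. to_nat u < n}"
    have fin: "finite (?F n)" for n
      by (rule finite_imageD[where f=to_nat]) (auto intro: finite_subset[of _ "{..<n}"] inj_on_subset[OF inj_to_nat])
    have sup: "(SUP n. ?f u * indicator (?F n) u) = ?f u" for u
    proof (rule antisym)
      show "(SUP n. ?f u * indicator (?F n) u) \<le> ?f u"
        by (intro SUP_least) (auto split: split_indicator)
      show "?f u \<le> (SUP n. ?f u * indicator (?F n) u)"
        by (rule SUP_upper2[of "Suc (to_nat u)"]) auto
    qed
    have "(\<integral>\<^sup>+u. ?f u \<partial>count_space UNIV)
        = (\<integral>\<^sup>+u. (SUP n. ?f u * indicator (?F n) u) \<partial>count_space UNIV)"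
      by (simp only: sup)
    also have "\<dots> = (SUP n. \<integral>\<^sup>+u. ?f u * indicator (?F n) u \<partial>count_space UNIV)"
      by (intro nn_integral_monotone_convergence_SUP)
         (auto simp: incseq_def le_fun_def split: split_indicator)
    also have "\<dots> = (SUP n. \<Sum>u\<in>?F n. ?f u)"
      using fin by (simp add: nn_integral_count_space_indicator[symmetric] nn_integral_count_space_finite)
    also have "\<dots> \<le> (SUP F\<in>{F. finite F}. \<Sum>u\<in>F. ?f u)"
      using fin by (intro SUP_least SUP_upper) auto
    finally show "(\<integral>\<^sup>+u. ?f u \<partial>count_space UNIV) \<le> (SUP F\<in>{F. finite F}. \<Sum>u\<in>F. ?f u)" .
  qed
  also have "\<dots> = (\<integral>\<^sup>+u. ennreal (V u) \<partial>measure_pmf q)"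
    by (subst nn_integral_measure_pmf) (simp add: mult.commute)
  finally show ?thesis .
qed

lemma Ionescu_Tulcea_markov_step:
  "Ionescu_Tulcea (markov_step \<mu> P) (\<lambda>_. count_space UNIV)"
proof (rule Ionescu_Tulcea.intro)
  fix i
  show "markov_step \<mu> P i \<in> measurable (PiM {0..<i} (\<lambda>_. count_space UNIV)) (subprob_algebra (count_space UNIV))"
  proof (cases i)
    case 0
    then show ?thesis
      by (simp add: markov_step_def[abs_def] measure_pmf_in_subprob_algebra)
  next
    case (Suc m)
    have "(\<lambda>\<omega>. \<omega> m) \<in> measurable (PiM {0..<i} (\<lambda>_. count_space UNIV :: 'a measure)) (count_space UNIV)"
      using Suc by (intro measurable_component_singleton) auto
    moreover have "(\<lambda>s. measure_pmf (P s)) \<in> measurable (count_space UNIV) (subprob_algebra (count_space UNIV))"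
      by (auto simp: measurable_count_space_eq1 measure_pmf_in_subprob_algebra)
    ultimately have "(\<lambda>\<omega>. measure_pmf (P (\<omega> m))) \<in> measurable (PiM {0..<i} (\<lambda>_. count_space UNIV)) (subprob_algebra (count_space UNIV))"
      by (rule measurable_compose)
    then show ?thesis
      using Suc by (simp add: markov_step_def[abs_def])
  qed
next
  fix i :: nat and x :: "nat \<Rightarrow> 'a"
  show "prob_space (markov_step \<mu> P i x)"
    by (simp add: markov_step_def measure_pmf.prob_space_axioms)
qed

interpretation MC: Ionescu_Tulcea "markov_step \<mu> P" "\<lambda>_. count_space UNIV" for \<mu> P
  by (rule Ionescu_Tulcea_markov_step)

lemma sets_markov_law [measurable_cong]:
  "sets (markov_law \<mu> P) = sets (\<Pi>\<^sub>M n\<in>UNIV. count_space UNIV)"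
  unfolding markov_law_def by (rule MC.PF.sets_lim)

lemma space_markov_law [simp]: "space (markov_law \<mu> P) = UNIV"
  unfolding markov_law_def by (subst MC.PF.space_lim) (simp add: space_PiM PiE_def extensional_def)

lemma emeasure_markov_law_cylinder:
  fixes P :: "'s :: countable \<Rightarrow> 's pmf"
  shows "emeasure (markov_law \<mu> P) {\<omega>. \<forall>j\<le>n. \<omega> j = x j}
     = ennreal (pmf \<mu> (x 0) * (\<Prod>j<n. pmf (P (x j)) (x (Suc j))))"
proof -
  let ?M = "\<lambda>_::nat. count_space UNIV :: 's measure"
  let ?r = "\<lambda>m. restrict x {0..<m}"
  have sing: "{?r m} \<in> sets (PiM {0..<m} ?M)" for m
  proof -
    have "{?r m} = PiE {0..<m} (\<lambda>j. {x j})"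
      by (auto simp: PiE_def extensional_def fun_eq_iff Pi_iff)
    then show ?thesis by (auto intro!: sets_PiM_I_finite)
  qed
  have C: "emeasure (MC.C \<mu> P 0 m (\<lambda>_. undefined)) {?r m}
      = (\<Prod>j<m. emeasure (markov_step \<mu> P j x) {x j})" for m
  proof (induction m)
    case 0
    then show ?case using sing[of 0] by (auto simp: indicator_def restrict_def)
  next
    case (Suc m)
    have u: "(\<lambda>_. undefined) \<in> space (PiM {0..<0} ?M)" by (simp add: space_PiM)
    have step: "emeasure (MC.eP \<mu> P m \<omega>) {?r (Suc m)}
         = emeasure (markov_step \<mu> P m x) {x m} * indicator {?r m} \<omega>"
      if \<omega>: "\<omega> \<in> space (PiM {0..<m} ?M)" for \<omega>
    proof -
      have und: "\<omega> j = undefined" if "j \<ge> m" for j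
        using \<omega> that by (auto simp: space_PiM PiE_def extensional_def)
      have eq: "fun_upd \<omega> m -` {?r (Suc m)} = (if \<omega> = ?r m then {x m} else {})"
      proof (cases "\<omega> = ?r m")
        case True
        have "y = x m" if "fun_upd \<omega> m y = ?r (Suc m)" for y
          using fun_cong[OF that, of m] by simp
        moreover have "fun_upd (?r m) m (x m) = ?r (Suc m)"
          by (rule ext) (simp add: less_Suc_eq)
        ultimately show ?thesis unfolding True by auto
      next
        case False
        then obtain j where j: "\<omega> j \<noteq> ?r m j" by (meson ext)
        with und[of j] have "j < m" by (cases "j < m") auto
        with j have "fun_upd \<omega> m y \<noteq> ?r (Suc m)" for y
          by (metis atLeastLessThan_iff fun_upd_other le0 less_SucI less_irrefl restrict_apply)
        with False show ?thesis by auto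
      qed
      have same: "markov_step \<mu> P m (?r m) = markov_step \<mu> P m x"
        by (auto simp: markov_step_def split: nat.split)
      show ?thesis
        by (subst MC.emeasure_eP[OF \<omega> sing]) (auto simp: eq same)
    qed
    have "emeasure (MC.C \<mu> P 0 (Suc m) (\<lambda>_. undefined)) {?r (Suc m)}
        = (\<integral>\<^sup>+\<omega>. emeasure (MC.eP \<mu> P m \<omega>) {?r (Suc m)} \<partial>MC.C \<mu> P 0 m (\<lambda>_. undefined))"
      using sing[of "Suc m"] u MC.measurable_eP[of \<mu> P m] MC.prob_space_C[OF u, THEN prob_space.not_empty]
      by (simp del: MC.sets_eP, subst emeasure_bind[where N="PiM {0..<Suc m} ?M"])
         (auto simp: MC.space_C[OF u] measurable_cong_sets[OF MC.sets_C[OF u]])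
    also have "\<dots> = (\<integral>\<^sup>+\<omega>. emeasure (markov_step \<mu> P m x) {x m} * indicator {?r m} \<omega>
                      \<partial>MC.C \<mu> P 0 m (\<lambda>_. undefined))"
      by (intro nn_integral_cong step) (simp add: MC.space_C[OF u])
    also have "\<dots> = emeasure (markov_step \<mu> P m x) {x m} * emeasure (MC.C \<mu> P 0 m (\<lambda>_. undefined)) {?r m}"
      using sing[of m] by (intro nn_integral_cmult_indicator) (simp add: MC.sets_C[OF u])
    finally show ?case
      unfolding Suc.IH by (simp only: prod.lessThan_Suc mult.commute)
  qed
  have emb: "{\<omega>. \<forall>j\<le>n. \<omega> j = x j} = MC.PF.emb UNIV {0..<Suc n} {?r (Suc n)}"
    by (auto simp: prod_emb_def space_PiM fun_eq_iff restrict_def less_Suc_eq_le split: if_splits)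
  have "emeasure (markov_law \<mu> P) {\<omega>. \<forall>j\<le>n. \<omega> j = x j}
      = emeasure (MC.CI \<mu> P {0..<Suc n}) {?r (Suc n)}"
    unfolding emb markov_law_def by (rule MC.lim) (use sing in auto)
  also have "\<dots> = emeasure (MC.C \<mu> P 0 (Suc n) (\<lambda>_. undefined))
      (MC.PF.emb {0..<Suc n} {0..<Suc n} {?r (Suc n)})"
    by (rule MC.emeasure_CI) (use sing in auto)
  also have "MC.PF.emb {0..<Suc n} {0..<Suc n} {?r (Suc n)} = {?r (Suc n)}"
    using sets.sets_into_space[OF sing] by (intro prod_emb_id) (simp add: space_PiM)
  also note C
  also have "(\<Prod>j<Suc n. emeasure (markov_step \<mu> P j x) {x j})
      = ennreal (pmf \<mu> (x 0) * (\<Prod>j<n. pmf (P (x j)) (x (Suc j))))"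
    by (subst prod.lessThan_Suc_shift)
       (simp add: markov_step_def emeasure_pmf_single prod_ennreal ennreal_mult prod_nonneg)
  finally show ?thesis .
qed

lemma measurable_markov_law_component [measurable]:
  "(\<lambda>\<omega>. \<omega> m) \<in> measurable (markov_law \<mu> P) (count_space UNIV)"
  by (subst measurable_cong_sets[OF sets_markov_law refl])
     (rule measurable_component_singleton, simp)

lemma sets_Fin_visits [measurable]: "Fin_visits A \<in> sets (markov_law \<mu> P)"
proof -
  have "Fin_visits A = (\<Union>n. \<Inter>m\<in>{n..}. (\<lambda>\<omega>. \<omega> m) -` (- A) \<inter> space (markov_law \<mu> P))"
    by (auto simp: Fin_visits_def)
  also have "\<dots> \<in> sets (markov_law \<mu> P)"
  proof (rule sets.countable_UN, clarify)
    show "(\<Inter>m\<in>{n..}. (\<lambda>\<omega>. \<omega> m) -` (- A) \<inter> space (markov_law \<mu> P)) \<in> sets (markov_law \<mu> P)" for n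
    proof (rule sets.countable_INT'')
      show "UNIV \<in> sets (markov_law \<mu> P)"
        using sets.top[of "markov_law \<mu> P"] by simp
      show "(\<lambda>\<omega>. \<omega> m) -` (- A) \<inter> space (markov_law \<mu> P) \<in> sets (markov_law \<mu> P)" for m
        by (rule measurable_sets[OF measurable_markov_law_component]) simp
    qed (rule countableI_type)
  qed
  finally show ?thesis .
qed

lemma sets_Inf_visits [measurable]: "Inf_visits A \<in> sets (markov_law \<mu> P)"
proof -
  have "Inf_visits A = space (markov_law \<mu> P) - Fin_visits A"
    by (auto simp: Inf_visits_def Fin_visits_def)
  then show ?thesis
    by (metis sets.compl_sets sets_Fin_visits)
qed

end

theory Submission
  imports Defs
begin

text \<open>
  Let \<open>\<phi>\<close> be the Streett event and \<open>g s\<close> the probability of its complement from \<open>s\<close>. As \<open>\<phi>\<close> is a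
  tail event, \<open>g\<close> is harmonic; take \<open>V0 = (1 + \<epsilon>) g\<close> and \<open>I = {V0 < 1}\<close>. Let \<open>V\<^sub>i\<close> be the probability
  of hitting \<open>A\<^sub>i\<close>, and \<open>J\<^sub>i = {s \<in> I. V\<^sub>i s \<le> 1/2}\<close>. If staying forever in a set has probability at
  most \<open>c < 1\<close> from each of its states, it has probability \<open>0\<close>. Applied twice, this shows that
  \<open>X = I - (B\<^sub>i \<union> J\<^sub>i)\<close> is left almost surely. On a countable state space, a set \<open>X\<close> that is left
  almost surely carries a nonnegative supermartingale \<open>W\<close> with finite sublevel sets, and the
  least number of steps to leave \<open>X\<close> with positive probability serves as \<open>U\<close>; finiteness of the
  sublevel sets gives the uniform bounds.
\<close>

subsection \<open>First-step decomposition\<close>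

text \<open>The marginal on the empty set of times is a probability measure, and a measure with such
  a marginal has total mass 1.\<close>

lemma prob_space_markov_law: "prob_space (markov_law \<mu> P)"
proof -
  interpret C: prob_space "MC.CI \<mu> P {}"
    by (rule MC.PF.prob_space_P) simp_all
  have "prob_space (distr (markov_law \<mu> P) (PiM {} (\<lambda>_. count_space UNIV)) (\<lambda>x. restrict x {}))"
    unfolding markov_law_def using MC.distr_lim[of "{}" \<mu> P] C.prob_space_axioms by simp
  moreover have "(\<lambda>x. restrict x {}) \<in> measurable (markov_law \<mu> P) (PiM {} (\<lambda>_. count_space UNIV))"
    by (subst measurable_cong_sets[OF sets_markov_law refl]) (rule measurable_restrict_subset, simp)
  ultimately show ?thesis
    by (rule prob_space_distrD[rotated])
qed

interpretation law: prob_space "markov_law \<mu> P" for \<mu> P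
  by (rule prob_space_markov_law)

lemma emeasure_markov_law_UNIV [simp]: "emeasure (markov_law \<mu> P) UNIV = 1"
  using law.emeasure_space_1[of \<mu> P] by simp

lemma sets_markov_law_Collect:
  "Measurable.pred (markov_law \<mu> P) Q \<Longrightarrow> {\<omega>. Q \<omega>} \<in> sets (markov_law \<mu> P)"
  by (drule predE) simp

lemma measurable_case_nat_markov_law [measurable]:
  "case_nat s \<in> measurable (markov_law \<mu> P) (\<Pi>\<^sub>M n\<in>UNIV. count_space UNIV)"
proof (rule measurable_PiM_single')
  show "(\<lambda>\<omega>. case_nat s \<omega> i) \<in> measurable (markov_law \<mu> P) (count_space UNIV)" for i
    by (cases i) auto
qed auto

text \<open>\<open>{}\<close> makes the family closed under intersection. \<open>UNIV\<close>, which
  need not be a cylinder because every cylinder fixes time 0, gives the trivial exhausting sequence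
  for uniqueness of measures.\<close>

definition cylinders :: "(nat \<Rightarrow> 's) set set" where
  "cylinders = insert {} (insert UNIV (range (\<lambda>(n, x). {\<omega>. \<forall>j\<le>n. \<omega> j = x j})))"

lemma cylinder_in_cylinders: "{\<omega>. \<forall>j\<le>n. \<omega> j = x j} \<in> cylinders"
  unfolding cylinders_def by (intro insertI2 range_eqI[of _ _ "(n, x)"]) simp

text \<open>Two prefixes either disagree on their common length, and the cylinders are disjoint, or
  one extends the other and the cylinder of the longer prefix is the intersection.\<close>

lemma Int_stable_cylinders: "Int_stable (cylinders :: (nat \<Rightarrow> 's) set set)"
proof -
  have *: "{\<omega>. \<forall>j\<le>n. \<omega> j = x j} \<inter> {\<omega>. \<forall>j\<le>m. \<omega> j = y j} \<in> cylinders"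
    if "n \<le> m" for n m and x y :: "nat \<Rightarrow> 's"
  proof (cases "\<forall>j\<le>n. x j = y j")
    case True
    then have "{\<omega>. \<forall>j\<le>n. \<omega> j = x j} \<inter> {\<omega>. \<forall>j\<le>m. \<omega> j = y j} = {\<omega>. \<forall>j\<le>m. \<omega> j = y j}"
      using that by auto
    then show ?thesis
      by (simp only: cylinder_in_cylinders)
  next
    case False
    then have "{\<omega>. \<forall>j\<le>n. \<omega> j = x j} \<inter> {\<omega>. \<forall>j\<le>m. \<omega> j = y j} = {}"
      using that order_trans by fastforce
    then show ?thesis
      by (simp add: cylinders_def)
  qed
  have "{\<omega>. \<forall>j\<le>n. \<omega> j = x j} \<inter> {\<omega>. \<forall>j\<le>m. \<omega> j = y j} \<in> cylinders"
    for n m and x y :: "nat \<Rightarrow> 's"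
    using *[of n m x y] *[of m n y x] by (cases "n \<le> m") (simp_all add: Int_commute)
  then show ?thesis
    unfolding Int_stable_def by (subst (1 2) cylinders_def) (auto simp: cylinders_def)
qed

lemma sets_PiM_eq_sigma_cylinders:
  "sets (\<Pi>\<^sub>M n\<in>UNIV. count_space (UNIV :: 's :: countable set)) = sigma_sets UNIV cylinders"
proof (rule antisym)
  have "sets (\<Pi>\<^sub>M n\<in>UNIV. count_space (UNIV :: 's set)) \<subseteq> sets (sigma UNIV cylinders)"
  proof (rule sets_PiM_in_sets)
    fix i :: nat and A :: "'s set"
    \<comment> \<open>Lists, unlike functions, form a countable type, so the union over prefixes is
      countable; lists that are too short do no harm.\<close>
    let ?cyl = "\<lambda>xs :: 's list. {\<omega>. \<forall>j\<le>i. \<omega> j = xs ! j}"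
    have "\<omega> \<in> (\<Union>xs\<in>{xs. xs ! i \<in> A}. ?cyl xs)" if "\<omega> i \<in> A" for \<omega>
      using that by (intro UN_I[of "map \<omega> [0..<Suc i]"]) (auto simp del: upt_Suc)
    then have "{\<omega>. \<omega> i \<in> A} = (\<Union>xs\<in>{xs. xs ! i \<in> A}. ?cyl xs)"
      by auto
    also have "\<dots> \<in> sets (sigma UNIV cylinders)"
      by (intro sets.countable_UN') (auto simp: cylinders_def)
    finally show "{\<omega> \<in> space (sigma UNIV cylinders). \<omega> i \<in> A} \<in> sets (sigma UNIV cylinders)"
      by simp
  qed auto
  then show "sets (\<Pi>\<^sub>M n\<in>UNIV. count_space (UNIV :: 's set)) \<subseteq> sigma_sets UNIV cylinders"
    by simp
  \<comment> \<open>Any chain would do: the sigma-algebra of \<open>markov_law\<close> does not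
    depend on its parameters.\<close>
  have "{\<omega>. \<forall>j\<le>n. \<omega> j = x j} \<in> sets (markov_law (return_pmf undefined) return_pmf)"
    for n and x :: "nat \<Rightarrow> 's"
    by (rule sets_markov_law_Collect) measurable
  then have "cylinders \<subseteq> sets (\<Pi>\<^sub>M n\<in>UNIV. count_space (UNIV :: 's set))"
    using sets.top[of "\<Pi>\<^sub>M n\<in>UNIV. count_space (UNIV :: 's set)"]
    by (auto simp: cylinders_def sets_markov_law space_PiM)
  then show "sigma_sets UNIV cylinders \<subseteq> sets (\<Pi>\<^sub>M n\<in>UNIV. count_space (UNIV :: 's set))"
    using sets.sigma_sets_subset[of cylinders "\<Pi>\<^sub>M n\<in>UNIV. count_space (UNIV :: 's set)"]
    by (simp add: space_PiM)
qed

text \<open>Markov property at time 1: prefixing \<open>s\<close> to a chain with initial law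
  \<open>P s\<close> and mixing over \<open>s\<close> by \<open>\<mu>\<close> gives a measure that
  agrees with the law of the chain on cylinders, hence everywhere. Throughout,
  \<open>markov_law (P s) P\<close> governs the path after \<open>s\<close>: its time 0 is one step
  after \<open>s\<close>.\<close>

lemma emeasure_markov_law_first_step:
  fixes P :: "'s :: countable \<Rightarrow> 's pmf"
  assumes E: "E \<in> sets (markov_law \<mu> P)"
  shows "emeasure (markov_law \<mu> P) E
    = (\<integral>\<^sup>+s. emeasure (markov_law (P s) P) {\<omega>. case_nat s \<omega> \<in> E} \<partial>measure_pmf \<mu>)"
proof -
  let ?S = "\<Pi>\<^sub>M n\<in>(UNIV :: nat set). count_space (UNIV :: 's set)"
  define K where "K s = distr (markov_law (P s) P) ?S (case_nat s)" for s
  have K: "K \<in> measurable (measure_pmf \<mu>) (subprob_algebra ?S)"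
  proof (subst measurable_pmf_measure1, rule Pi_I)
    fix s
    have "prob_space (K s)"
      unfolding K_def by (rule law.prob_space_distr) measurable
    then show "K s \<in> space (subprob_algebra ?S)"
      by (simp add: space_subprob_algebra K_def prob_space_imp_subprob_space)
  qed
  have KE: "emeasure (K s) E = emeasure (markov_law (P s) P) {\<omega>. case_nat s \<omega> \<in> E}"
    if "E \<in> sets ?S" for s E
    using that by (simp add: K_def emeasure_distr vimage_def)
  define N where "N = measure_pmf \<mu> \<bind> K"
  have N: "emeasure N E
      = (\<integral>\<^sup>+s. emeasure (markov_law (P s) P) {\<omega>. case_nat s \<omega> \<in> E} \<partial>measure_pmf \<mu>)"
    if "E \<in> sets ?S" for E
    unfolding N_def using K that by (subst emeasure_bind) (auto simp: KE)
  have setsN: "sets N = sets ?S"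
    unfolding N_def by (rule sets_bind) (auto simp: K_def)
  have "markov_law \<mu> P = N"
  proof (rule measure_eqI_generator_eq[where E = cylinders and \<Omega> = UNIV and A = "\<lambda>_. UNIV"])
    fix X :: "(nat \<Rightarrow> 's) set" assume X: "X \<in> cylinders"
    then have XS: "X \<in> sets ?S"
      by (simp add: sets_PiM_eq_sigma_cylinders)
    consider "X = {}" | "X = UNIV" | n x where "X = {\<omega>. \<forall>j\<le>n. \<omega> j = x j}"
      using X by (auto simp: cylinders_def)
    then show "emeasure (markov_law \<mu> P) X = emeasure N X"
    proof cases
      case 2
      then show ?thesis
        using N[OF XS] by simp
    next
      case (3 n x)
      let ?c = "\<Prod>j<n. pmf (P (x j)) (x (Suc j))"
      have *: "emeasure (markov_law (P s) P) {\<omega>. case_nat s \<omega> \<in> X} = ennreal ?c * indicator {x 0} s"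
        for s
      proof (cases "s = x 0")
        case False
        then have "{\<omega>. case_nat s \<omega> \<in> X} = {}"
          using 3 by auto
        with False show ?thesis by simp
      next
        case True
        show ?thesis
        \<comment> \<open>For \<open>n = 0\<close> the cylinder constrains only the prefixed state;
          otherwise what remains is a cylinder one step shorter.\<close>
        proof (cases n)
          case 0
          with 3 True have "{\<omega>. case_nat s \<omega> \<in> X} = UNIV"
            by auto
          with 0 True show ?thesis by simp
        next
          case (Suc m)
          have "(\<forall>j\<le>Suc m. case_nat s \<omega> j = x j) \<longleftrightarrow> (\<forall>j\<le>m. \<omega> j = x (Suc j))" for \<omega>
            using True by (metis Suc_le_mono le0 nat.exhaust nat.simps(4,5))
          then have "{\<omega>. case_nat s \<omega> \<in> X} = {\<omega>. \<forall>j\<le>m. \<omega> j = x (Suc j)}"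
            using 3 Suc by simp
          then show ?thesis
            using emeasure_markov_law_cylinder[of "P s" P m "\<lambda>j. x (Suc j)"] True Suc
            by (simp add: prod.lessThan_Suc_shift del: prod.lessThan_Suc)
        qed
      qed
      have "emeasure N X = ennreal ?c * ennreal (pmf \<mu> (x 0))"
        unfolding N[OF XS] * by (subst nn_integral_cmult_indicator) (auto simp: emeasure_pmf_single)
      then show ?thesis
        unfolding 3 emeasure_markov_law_cylinder
        by (simp add: ennreal_mult prod_nonneg mult.commute)
    qed simp
  next
    show "sets (markov_law \<mu> P) = sigma_sets UNIV cylinders"
      by (simp add: sets_markov_law sets_PiM_eq_sigma_cylinders)
    show "sets N = sigma_sets UNIV cylinders"
      by (simp add: setsN sets_PiM_eq_sigma_cylinders)
  qed (auto simp: Int_stable_cylinders, auto simp: cylinders_def)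
  then show ?thesis
    using N[of E] E setsN by simp
qed

lemma measure_markov_law_first_step:
  fixes P :: "'s :: countable \<Rightarrow> 's pmf"
  assumes "E \<in> sets (markov_law \<mu> P)"
  shows "ennreal (measure (markov_law \<mu> P) E)
    = (\<integral>\<^sup>+s. ennreal (measure (markov_law (P s) P) {\<omega>. case_nat s \<omega> \<in> E}) \<partial>measure_pmf \<mu>)"
  using emeasure_markov_law_first_step[OF assms] by (simp add: law.emeasure_eq_measure)

subsection \<open>Staying in a set forever\<close>

lemma sets_Collect_ball_in [measurable]:
  "{\<omega>. \<forall>j\<in>J. \<omega> j \<in> X} \<in> sets (markov_law \<mu> P)"
proof -
  have "{\<omega>. \<forall>j\<in>J. \<omega> j \<in> X} = (\<Inter>j\<in>J. {\<omega>. \<omega> j \<in> X})"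
    by auto
  also have "\<dots> \<in> sets (markov_law \<mu> P)"
  proof (rule sets.countable_INT'')
    show "UNIV \<in> sets (markov_law \<mu> P)"
      using sets.top[of "markov_law \<mu> P"] by simp
    show "{\<omega>. \<omega> j \<in> X} \<in> sets (markov_law \<mu> P)" for j
      using measurable_sets[OF measurable_markov_law_component, of X j \<mu> P]
      by (simp add: vimage_def)
  qed (rule countableI_type)
  finally show ?thesis .
qed

lemma sets_stay [measurable]: "{\<omega>. \<forall>j<n. \<omega> j \<in> X} \<in> sets (markov_law \<mu> P)" for n :: nat
  using sets_Collect_ball_in[of "{..<n}"] by (simp add: Ball_def)

lemma sets_always [measurable]: "{\<omega>. \<forall>j\<ge>n. \<omega> j \<in> X} \<in> sets (markov_law \<mu> P)" for n :: nat
  using sets_Collect_ball_in[of "{n..}"] by (simp add: Ball_def)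

lemma sets_forever [measurable]: "{\<omega>. \<forall>j. \<omega> j \<in> X} \<in> sets (markov_law \<mu> P)"
  using sets_Collect_ball_in[of UNIV] by simp

lemma emeasure_stay_Suc:
  fixes P :: "'s :: countable \<Rightarrow> 's pmf"
  shows "emeasure (markov_law \<mu> P) {\<omega>. \<forall>j<Suc n. \<omega> j \<in> X}
    = (\<integral>\<^sup>+s. emeasure (markov_law (P s) P) {\<omega>. \<forall>j<n. \<omega> j \<in> X} * indicator X s \<partial>measure_pmf \<mu>)"
proof -
  have "{\<omega>. case_nat s \<omega> \<in> {\<omega>. \<forall>j<Suc n. \<omega> j \<in> X}}
      = (if s \<in> X then {\<omega>. \<forall>j<n. \<omega> j \<in> X} else {})" for s
    by (auto simp: less_Suc_eq_0_disj)
  then show ?thesis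
    by (subst emeasure_markov_law_first_step[OF sets_stay]) (auto intro!: nn_integral_cong)
qed

lemma emeasure_forever:
  fixes P :: "'s :: countable \<Rightarrow> 's pmf"
  shows "emeasure (markov_law \<mu> P) {\<omega>. \<forall>j. \<omega> j \<in> X}
    = (\<integral>\<^sup>+s. emeasure (markov_law (P s) P) {\<omega>. \<forall>j. \<omega> j \<in> X} * indicator X s \<partial>measure_pmf \<mu>)"
proof -
  have "{\<omega>. case_nat s \<omega> \<in> {\<omega>. \<forall>j. \<omega> j \<in> X}} = (if s \<in> X then {\<omega>. \<forall>j. \<omega> j \<in> X} else {})" for s
    by (auto split: nat.splits)
  then show ?thesis
    by (subst emeasure_markov_law_first_step[OF sets_forever]) (auto intro!: nn_integral_cong)
qed

lemma stay_tendsto_forever: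
  "(\<lambda>n. measure (markov_law \<mu> P) {\<omega>. \<forall>j<n. \<omega> j \<in> X})
    \<longlonglongrightarrow> measure (markov_law \<mu> P) {\<omega>. \<forall>j. \<omega> j \<in> X}"
proof -
  have "(\<Inter>n. {\<omega> :: nat \<Rightarrow> 'a. \<forall>j<n. \<omega> j \<in> X}) = {\<omega>. \<forall>j. \<omega> j \<in> X}"
    by auto
  moreover have "(\<lambda>n. measure (markov_law \<mu> P) {\<omega>. \<forall>j<n. \<omega> j \<in> X})
    \<longlonglongrightarrow> measure (markov_law \<mu> P) (\<Inter>n. {\<omega>. \<forall>j<n. \<omega> j \<in> X})"
    by (rule law.finite_Lim_measure_decseq) (auto simp: decseq_def)
  ultimately show ?thesis
    by simp
qed

text \<open>By the Markov property, the probability of staying for \<open>n\<close> steps and then forever is at most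
  \<open>c\<close> times the probability of staying for \<open>n\<close> steps; hence \<open>q \<le> c * q\<close> in the limit.\<close>

lemma forever_null_if_bounded:
  fixes P :: "'s :: countable \<Rightarrow> 's pmf"
  assumes c: "c < 1"
    and bound: "\<And>s. s \<in> X \<Longrightarrow> measure (markov_law (P s) P) {\<omega>. \<forall>j. \<omega> j \<in> X} \<le> c"
  shows "measure (markov_law \<mu> P) {\<omega>. \<forall>j. \<omega> j \<in> X} = 0"
proof -
  \<comment> \<open>\<open>c\<close> can be negative when \<open>X\<close> is empty;
    \<open>ennreal\<close> needs a nonnegative constant.\<close>
  define d where "d = max 0 c"
  have d: "0 \<le> d" "d < 1" "c \<le> d"
    using c by (auto simp: d_def)
  let ?c = "ennreal d"
  have "emeasure (markov_law \<nu> P) {\<omega>. \<forall>j. \<omega> j \<in> X}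
      \<le> ?c * emeasure (markov_law \<nu> P) {\<omega>. \<forall>j<n. \<omega> j \<in> X}" for n \<nu>
  \<comment> \<open>The initial law is generalized because the first step replaces it by
    \<open>P s\<close>.\<close>
  proof (induction n arbitrary: \<nu>)
    case 0
    have "emeasure (markov_law \<nu> P) {\<omega>. \<forall>j. \<omega> j \<in> X} \<le> (\<integral>\<^sup>+s. ?c \<partial>measure_pmf \<nu>)"
      unfolding emeasure_forever[of \<nu>]
      by (intro nn_integral_mono)
         (auto simp: law.emeasure_eq_measure intro!: ennreal_leI order_trans[OF bound d(3)] split: split_indicator)
    then show ?case by simp
  next
    case (Suc n)
    have "emeasure (markov_law \<nu> P) {\<omega>. \<forall>j. \<omega> j \<in> X}
        \<le> (\<integral>\<^sup>+s. ?c * (emeasure (markov_law (P s) P) {\<omega>. \<forall>j<n. \<omega> j \<in> X} * indicator X s)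
              \<partial>measure_pmf \<nu>)"
      unfolding emeasure_forever[of \<nu>]
      by (intro nn_integral_mono) (auto intro: Suc.IH split: split_indicator)
    then show ?case
      unfolding emeasure_stay_Suc by (simp add: nn_integral_cmult)
  qed
  then have *: "measure (markov_law \<mu> P) {\<omega>. \<forall>j. \<omega> j \<in> X}
      \<le> d * measure (markov_law \<mu> P) {\<omega>. \<forall>j<n. \<omega> j \<in> X}" for n
    using d by (simp add: law.emeasure_eq_measure flip: ennreal_mult)
  have "measure (markov_law \<mu> P) {\<omega>. \<forall>j. \<omega> j \<in> X}
      \<le> d * measure (markov_law \<mu> P) {\<omega>. \<forall>j. \<omega> j \<in> X}"
    by (rule LIMSEQ_le_const[OF tendsto_mult_left[OF stay_tendsto_forever]]) (use * in auto)
  then have "(1 - d) * measure (markov_law \<mu> P) {\<omega>. \<forall>j. \<omega> j \<in> X} \<le> 0"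
    by (simp add: algebra_simps)
  then show ?thesis
    using d measure_nonneg[of "markov_law \<mu> P" "{\<omega>. \<forall>j. \<omega> j \<in> X}"]
    by (auto simp: mult_le_0_iff)
qed

text \<open>The hypothesis covers every initial law, and dropping one step of the path only replaces
  \<open>\<mu>\<close> by some \<open>P s\<close>.\<close>

lemma eventually_forever_null:
  fixes P :: "'s :: countable \<Rightarrow> 's pmf"
  assumes null: "\<And>\<mu>. measure (markov_law \<mu> P) {\<omega>. \<forall>j. \<omega> j \<in> X} = 0"
  shows "measure (markov_law \<mu> P) {\<omega>. \<forall>j\<ge>n. \<omega> j \<in> X} = 0"
proof (induction n arbitrary: \<mu>)
  case 0
  then show ?case by (simp add: null)
next
  case (Suc n)
  have "{\<omega>. case_nat s \<omega> \<in> {\<omega>. \<forall>j\<ge>Suc n. \<omega> j \<in> X}} = {\<omega>. \<forall>j\<ge>n. \<omega> j \<in> X}" for s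
    by (auto simp: Suc_le_eq split: nat.splits)
  then show ?case
    using measure_markov_law_first_step[OF sets_always[of "Suc n" X \<mu> P]] by (simp add: Suc.IH)
qed

subsection \<open>Lyapunov functions for sets that are left almost surely\<close>

text \<open>On \<open>X\<close>, \<open>U s\<close> is the least \<open>n\<close> for which the next
  \<open>n\<close> states lie in \<open>X\<close> with probability below 1; it exists because
  staying forever is null. If no successor were closer to the exit, all of them would lie in
  \<open>X\<close> and stay one step less with probability 1, contradicting the choice of
  \<open>n\<close>.\<close>

lemma exit_distance:
  fixes P :: "'s :: countable \<Rightarrow> 's pmf"
  assumes null: "\<And>\<mu>. measure (markov_law \<mu> P) {\<omega>. \<forall>j. \<omega> j \<in> X} = 0"
  obtains U :: "'s \<Rightarrow> nat"
  where "\<And>s. s \<notin> X \<Longrightarrow> U s = 0"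
    and "\<And>s. s \<in> X \<Longrightarrow> 0 < measure_pmf.prob (P s) {u. U u < U s}"
proof -
  let ?stay = "\<lambda>n s. measure (markov_law (P s) P) {\<omega>. \<forall>j<n. \<omega> j \<in> X}"
  define U where "U s = (if s \<in> X then LEAST n. ?stay n s < 1 else 0)" for s
  show thesis
  proof (rule that[of U])
    show "U s = 0" if "s \<notin> X" for s
      using that by (simp add: U_def)
    fix s assume s: "s \<in> X"
    have "eventually (\<lambda>n. ?stay n s < 1) sequentially"
      using stay_tendsto_forever[of "P s" P X] unfolding null by (rule order_tendstoD) simp
    then have ex: "\<exists>n. ?stay n s < 1"
      by (auto simp: eventually_sequentially)
    have less: "?stay (U s) s < 1"
      using LeastI_ex[OF ex] s by (simp add: U_def)
    \<comment> \<open>Staying for zero steps has probability 1, so the least index is not 0.\<close>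
    then obtain m where m: "U s = Suc m"
      by (cases "U s") (auto simp: law.prob_space[simplified])
    show "0 < measure_pmf.prob (P s) {u. U u < U s}"
    proof (rule ccontr)
      assume "\<not> 0 < measure_pmf.prob (P s) {u. U u < U s}"
      then have "measure_pmf.prob (P s) {u. U u < U s} = 0"
        by (simp add: zero_less_measure_iff)
      then have "\<not> U u < U s" if "u \<in> set_pmf (P s)" for u
        using that by (auto simp: measure_pmf_zero_iff)
      \<comment> \<open>\<open>U u \<ge> Suc m\<close> excludes the value 0 taken off
        \<open>X\<close>, and \<open>m\<close> lies below the least index for
        \<open>u\<close>.\<close>
      then have *: "u \<in> X \<and> ?stay m u = 1" if "u \<in> set_pmf (P s)" for u
        using that m not_less_Least[of m "\<lambda>n. ?stay n u < 1"]
        by (fastforce simp: U_def not_less Suc_le_eq intro: antisym law.prob_le_1 split: if_splits)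
      have "emeasure (markov_law (P s) P) {\<omega>. \<forall>j<Suc m. \<omega> j \<in> X} = (\<integral>\<^sup>+u. 1 \<partial>measure_pmf (P s))"
        unfolding emeasure_stay_Suc
        by (intro nn_integral_cong_AE AE_pmfI) (simp add: * law.emeasure_eq_measure)
      then show False
        using less m by (simp add: law.emeasure_eq_measure)
    qed
  qed
qed

text \<open>\<open>W\<close> sums the probabilities of reaching \<open>{u \<in> X. N j \<le> to_nat u}\<close> before leaving \<open>X\<close>, for
  \<open>N\<close> growing so fast that the sum converges; on states with large \<open>to_nat\<close> many summands are \<open>1\<close>.\<close>

lemma exit_supermartingale:
  fixes P :: "'s :: countable \<Rightarrow> 's pmf"
  assumes null: "\<And>\<mu>. measure (markov_law \<mu> P) {\<omega>. \<forall>j. \<omega> j \<in> X} = 0"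
  obtains W :: "'s \<Rightarrow> real"
  where "\<And>s. s \<notin> X \<Longrightarrow> W s = 0"
    and "\<And>s. s \<in> X \<Longrightarrow> 0 < W s"
    and "\<And>s. s \<in> X \<Longrightarrow> (\<integral>\<^sup>+u. ennreal (W u) \<partial>measure_pmf (P s)) \<le> ennreal (W s)"
    and "\<And>r. finite {s \<in> X. W s \<le> r}"
proof -
  define E :: "nat \<Rightarrow> (nat \<Rightarrow> 's) set"
    where "E n = {\<omega>. \<exists>m. \<omega> m \<in> X \<and> n \<le> to_nat (\<omega> m) \<and> (\<forall>j<m. \<omega> j \<in> X)}" for n
  \<comment> \<open>\<open>w n s\<close> is the probability of \<open>E n\<close> for the path that
    includes \<open>s\<close> itself as its first state; \<open>E_Cons\<close> justifies the case
    distinction.\<close>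
  define w where "w n s = (if s \<in> X then if n \<le> to_nat s then 1
      else measure (markov_law (P s) P) (E n) else 0)" for n s
  have sets_E [measurable]: "E n \<in> sets (markov_law \<nu> P)" for n \<nu>
  proof -
    have "E n = (\<Union>m. {\<omega>. \<forall>j\<in>{m}. \<omega> j \<in> X \<inter> {u. n \<le> to_nat u}} \<inter> {\<omega>. \<forall>j<m. \<omega> j \<in> X})"
      by (auto simp: E_def)
    also have "\<dots> \<in> sets (markov_law \<nu> P)"
      by (intro sets.countable_UN image_subsetI sets.Int sets_Collect_ball_in sets_stay)
    finally show ?thesis .
  qed
  have w_nonneg: "0 \<le> w n s" for n s
    by (simp add: w_def)
  have E_Cons: "case_nat s \<omega> \<in> E n \<longleftrightarrow> s \<in> X \<and> (n \<le> to_nat s \<or> \<omega> \<in> E n)" for s \<omega> n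
  proof
    assume "case_nat s \<omega> \<in> E n"
    then obtain m where m: "case_nat s \<omega> m \<in> X" "n \<le> to_nat (case_nat s \<omega> m)"
      "\<And>j. j < m \<Longrightarrow> case_nat s \<omega> j \<in> X"
      by (auto simp: E_def)
    show "s \<in> X \<and> (n \<le> to_nat s \<or> \<omega> \<in> E n)"
    proof (cases m)
      case (Suc l)
      then show ?thesis
        using m(1,2) m(3)[of 0] m(3)[of "Suc _"] by (auto simp: E_def)
    qed (use m in auto)
  next
    assume *: "s \<in> X \<and> (n \<le> to_nat s \<or> \<omega> \<in> E n)"
    show "case_nat s \<omega> \<in> E n"
    proof (cases "n \<le> to_nat s")
      case True
      with * show ?thesis
        by (auto simp: E_def intro!: exI[of _ 0])
    next
      case False
      with * obtain m where "\<omega> m \<in> X" "n \<le> to_nat (\<omega> m)" "\<forall>j<m. \<omega> j \<in> X"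
        by (auto simp: E_def)
      with * show ?thesis
        by (auto simp: E_def less_Suc_eq_0_disj intro!: exI[of _ "Suc m"])
    qed
  qed
  have w_step: "(\<integral>\<^sup>+s. ennreal (w n s) \<partial>measure_pmf \<nu>) = ennreal (measure (markov_law \<nu> P) (E n))" for n \<nu>
    unfolding measure_markov_law_first_step[OF sets_E]
    by (intro nn_integral_cong) (auto simp: E_Cons w_def law.prob_space[simplified])
  \<comment> \<open>On \<open>X\<close>, \<open>w n s\<close> either equals the probability of
    \<open>E n\<close> after \<open>s\<close> or is 1.\<close>
  have w_super: "(\<integral>\<^sup>+u. ennreal (w n u) \<partial>measure_pmf (P s)) \<le> ennreal (w n s)" if "s \<in> X" for n s
    unfolding w_step using that by (intro ennreal_leI) (auto simp: w_def)
  have w_lim: "(\<lambda>n. w n s) \<longlonglongrightarrow> 0" for s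
  proof -
    \<comment> \<open>A path that leaves \<open>X\<close> at time \<open>k\<close> sees only
      finitely many states before \<open>k\<close>, so their codes are bounded and it misses some
      \<open>E n\<close>. The intersection of all \<open>E n\<close> is therefore null.\<close>
    have "\<forall>j. \<omega> j \<in> X" if \<omega>: "\<And>n. \<omega> \<in> E n" for \<omega>
    proof (rule ccontr)
      assume "\<not> (\<forall>j. \<omega> j \<in> X)"
      then obtain k where k: "\<omega> k \<notin> X"
        by auto
      obtain m where m: "\<omega> m \<in> X" "Suc (\<Sum>j<k. to_nat (\<omega> j)) \<le> to_nat (\<omega> m)" "\<forall>j<m. \<omega> j \<in> X"
        using \<omega>[of "Suc (\<Sum>j<k. to_nat (\<omega> j))"] by (auto simp: E_def)
      have "m < k"
        using k m(1,3) by (metis linorder_neqE_nat)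
      then have "to_nat (\<omega> m) \<le> (\<Sum>j<k. to_nat (\<omega> j))"
        by (intro member_le_sum) auto
      with m(2) show False by simp
    qed
    then have "(\<Inter>n. E n) \<subseteq> {\<omega>. \<forall>j. \<omega> j \<in> X}"
      by auto
    then have "measure (markov_law (P s) P) (\<Inter>n. E n) = 0"
      using law.finite_measure_mono[OF _ sets_forever, of "\<Inter>n. E n" X "P s" P] null[of "P s"]
      by (simp add: antisym)
    moreover have "decseq E"
      by (fastforce simp: decseq_def E_def)
    then have "(\<lambda>n. measure (markov_law (P s) P) (E n)) \<longlonglongrightarrow> measure (markov_law (P s) P) (\<Inter>n. E n)"
      by (intro law.finite_Lim_measure_decseq) auto
    ultimately have "(\<lambda>n. measure (markov_law (P s) P) (E n)) \<longlonglongrightarrow> 0"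
      by simp
    \<comment> \<open>Beyond \<open>to_nat s\<close> the branch with value 1 no longer applies to
      \<open>s\<close>.\<close>
    moreover have "eventually (\<lambda>n. norm (w n s) \<le> measure (markov_law (P s) P) (E n)) sequentially"
      using eventually_gt_at_top[of "to_nat s"] by eventually_elim (auto simp: w_def)
    ultimately show ?thesis
      by (rule Lim_null_comparison[rotated])
  qed
  \<comment> \<open>Only finitely many states have code at most \<open>j\<close>, so one index
    serves them all. Each \<open>s\<close> is covered from \<open>j = to_nat s\<close> on, which
    gives comparison with a geometric series.\<close>
  have "\<exists>n. \<forall>s\<in>{s. to_nat s \<le> j}. w n s < (1/2) ^ j" for j
  proof -
    have "finite {s :: 's. to_nat s \<le> j}"
      by (rule finite_subset[OF _ finite_vimageI[OF finite_atMost[of j] inj_to_nat]]) auto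
    then have "eventually (\<lambda>n. \<forall>s\<in>{s. to_nat s \<le> j}. w n s < (1/2) ^ j) sequentially"
      by (rule eventually_ball_finite) (auto intro!: order_tendstoD[OF w_lim])
    then show ?thesis
      by (auto simp: eventually_sequentially)
  qed
  then obtain N where N: "\<And>j s. to_nat s \<le> j \<Longrightarrow> w (N j) s < (1/2) ^ j"
    by (metis (mono_tags) mem_Collect_eq)
  have summable: "summable (\<lambda>j. w (N j) s)" for s
    by (rule summable_comparison_test'[of "\<lambda>j. (1/2) ^ j" "to_nat s"])
       (auto simp: w_nonneg intro: less_imp_le[OF N])
  \<comment> \<open>The indicator makes \<open>W\<close> positive on \<open>X\<close> even where the
    series vanishes. It keeps the supermartingale inequality, being maximal at every state of
    \<open>X\<close>.\<close>
  define W where "W s = indicator X s + (\<Sum>j. w (N j) s)" for s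
  have sum_nonneg: "0 \<le> (\<Sum>j. w (N j) s)" for s
    by (intro suminf_nonneg summable w_nonneg)
  show thesis
  proof (rule that[of W])
    show "W s = 0" if "s \<notin> X" for s
      using that by (simp add: W_def w_def)
    show "0 < W s" if "s \<in> X" for s
      using that sum_nonneg[of s] by (simp add: W_def)
    show "(\<integral>\<^sup>+u. ennreal (W u) \<partial>measure_pmf (P s)) \<le> ennreal (W s)" if s: "s \<in> X" for s
    proof -
      have sum_eq: "ennreal (\<Sum>j. w (N j) u) = (\<Sum>j. ennreal (w (N j) u))" for u
        by (rule suminf_ennreal2[symmetric]) (auto simp: w_nonneg summable)
      have "(\<integral>\<^sup>+u. ennreal (W u) \<partial>measure_pmf (P s))
          \<le> (\<integral>\<^sup>+u. 1 + (\<Sum>j. ennreal (w (N j) u)) \<partial>measure_pmf (P s))"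
        unfolding W_def
        by (intro nn_integral_mono) (auto simp: sum_nonneg ennreal_plus sum_eq split: split_indicator)
      also have "\<dots> = 1 + (\<Sum>j. \<integral>\<^sup>+u. ennreal (w (N j) u) \<partial>measure_pmf (P s))"
        by (simp add: nn_integral_add nn_integral_suminf)
      also have "\<dots> \<le> 1 + (\<Sum>j. ennreal (w (N j) s))"
        by (intro add_mono suminf_le w_super s) auto
      also have "\<dots> = ennreal (W s)"
        using s by (simp add: W_def sum_eq[symmetric] sum_nonneg ennreal_plus)
      finally show ?thesis .
    qed
    show "finite {s \<in> X. W s \<le> r}" for r
    proof -
      \<comment> \<open>A state of \<open>X\<close> with code at least \<open>N j\<close> for all
        \<open>j < K\<close> has \<open>K\<close> summands equal to 1, so \<open>W\<close> is at
        least \<open>K + 1 > r\<close>.\<close>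
      define K where "K = nat \<lceil>r\<rceil>"
      define M where "M = (\<Sum>j<K. N j)"
      have "to_nat s < M" if s: "s \<in> X" "W s \<le> r" for s
      proof (rule ccontr)
        assume "\<not> to_nat s < M"
        moreover have "N j \<le> M" if "j < K" for j
          unfolding M_def using that by (intro member_le_sum) auto
        ultimately have "N j \<le> to_nat s" if "j < K" for j
          using that by (meson le_trans not_less)
        then have "w (N j) s = 1" if "j < K" for j
          using that s by (simp add: w_def)
        then have "real K = (\<Sum>j<K. w (N j) s)"
          by simp
        also have "\<dots> \<le> (\<Sum>j. w (N j) s)"
          by (intro sum_le_suminf summable w_nonneg) auto
        finally have "real K + 1 \<le> W s"
          using s by (simp add: W_def)
        then show False
          using s unfolding K_def by linarith
      qed
      then have "{s \<in> X. W s \<le> r} \<subseteq> to_nat -` {..<M}"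
        by auto
      then show ?thesis
        by (rule finite_subset) (intro finite_vimageI inj_to_nat finite_lessThan)
    qed
  qed
qed

subsection \<open>Streett pairs\<close>

lemma mem_Fin_visits_iff: "\<omega> \<in> Fin_visits A \<longleftrightarrow> (\<exists>n. \<forall>m\<ge>n. \<omega> m \<notin> A)"
  by (auto simp: Fin_visits_def)

lemma Inf_visits_eq: "Inf_visits A = - Fin_visits A"
  by (auto simp: Inf_visits_def Fin_visits_def)

text \<open>A finite prefix does not affect eventual behaviour. This makes the Streett event shift
  invariant and its failure probability harmonic.\<close>

lemma case_nat_in_Fin_visits [simp]: "case_nat s \<omega> \<in> Fin_visits A \<longleftrightarrow> \<omega> \<in> Fin_visits A"
  unfolding mem_Fin_visits_iff
proof
  assume "\<exists>n. \<forall>m\<ge>n. case_nat s \<omega> m \<notin> A"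
  then obtain n where n: "\<And>m. n \<le> m \<Longrightarrow> case_nat s \<omega> m \<notin> A"
    by auto
  have "\<omega> m \<notin> A" if "n \<le> m" for m
    using n[of "Suc m"] that by simp
  then show "\<exists>n. \<forall>m\<ge>n. \<omega> m \<notin> A"
    by auto
next
  assume "\<exists>n. \<forall>m\<ge>n. \<omega> m \<notin> A"
  then obtain n where "\<forall>m\<ge>n. \<omega> m \<notin> A"
    by auto
  then have "\<forall>m\<ge>Suc n. case_nat s \<omega> m \<notin> A"
    by (auto simp: Suc_le_eq split: nat.splits)
  then show "\<exists>n. \<forall>m\<ge>n. case_nat s \<omega> m \<notin> A"
    by blast
qed

lemma case_nat_in_Inf_visits [simp]: "case_nat s \<omega> \<in> Inf_visits A \<longleftrightarrow> \<omega> \<in> Inf_visits A"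
  by (simp add: Inf_visits_eq)

lemma sets_visits [measurable]: "{\<omega>. \<exists>j. \<omega> j \<in> A} \<in> sets (markov_law \<mu> P)"
proof -
  have "{\<omega>. \<exists>j. \<omega> j \<in> A} = space (markov_law \<mu> P) - {\<omega>. \<forall>j. \<omega> j \<in> - A}"
    by auto
  then show ?thesis
    by (metis sets.compl_sets sets_forever)
qed

text \<open>\<open>markov_law (P s) P\<close> does not see \<open>s\<close>, so the first branch
  counts a visit at time 0.\<close>

definition hit_prob :: "('s \<Rightarrow> 's pmf) \<Rightarrow> 's set \<Rightarrow> 's \<Rightarrow> real" where
  "hit_prob P A s = (if s \<in> A then 1 else measure (markov_law (P s) P) {\<omega>. \<exists>j. \<omega> j \<in> A})"

text \<open>With \<open>P s\<close> as initial law this yields harmonicity of the hitting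
  probability off \<open>A\<close>.\<close>

lemma nn_integral_hit_prob:
  fixes P :: "'s :: countable \<Rightarrow> 's pmf"
  shows "(\<integral>\<^sup>+s. ennreal (hit_prob P A s) \<partial>measure_pmf \<mu>)
    = ennreal (measure (markov_law \<mu> P) {\<omega>. \<exists>j. \<omega> j \<in> A})"
proof -
  have "{\<omega>. case_nat s \<omega> \<in> {\<omega>. \<exists>j. \<omega> j \<in> A}} = (if s \<in> A then UNIV else {\<omega>. \<exists>j. \<omega> j \<in> A})" for s
    by (auto, (metis nat.exhaust nat.simps(4,5))+)
  then show ?thesis
    unfolding measure_markov_law_first_step[OF sets_visits]
    by (intro nn_integral_cong) (auto simp: hit_prob_def law.prob_space[simplified])
qed

text \<open>First \<open>X - A\<close> is left almost surely, because from each of its states \<open>A\<close> is hit with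
  probability at least \<open>1/2\<close>. So a run of \<open>\<phi>\<close> that avoids \<open>B\<close> cannot stay in \<open>X\<close>, and
  staying in \<open>X\<close> has probability at most that of \<open>- \<phi>\<close>.\<close>

lemma streett_pair_forever_null:
  fixes P :: "'s :: countable \<Rightarrow> 's pmf"
  assumes sets: "\<And>\<mu>. \<phi> \<in> sets (markov_law \<mu> P)"
    and \<phi>: "\<phi> \<subseteq> Fin_visits A \<union> Inf_visits B"
    and c: "c < 1" "\<And>s. s \<in> X \<Longrightarrow> measure (markov_law (P s) P) (- \<phi>) \<le> c"
    and hit: "\<And>s. s \<in> X \<Longrightarrow> 1/2 \<le> hit_prob P A s"
    and B: "X \<inter> B = {}"
  shows "measure (markov_law \<mu> P) {\<omega>. \<forall>j. \<omega> j \<in> X} = 0"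
proof (rule forever_null_if_bounded[OF c(1)])
  have sets_compl: "- \<phi> \<in> sets (markov_law \<nu> P)" for \<nu>
    using sets.compl_sets[OF sets, of \<nu>] by (simp add: Compl_eq_Diff_UNIV)
  have XA: "measure (markov_law \<nu> P) {\<omega>. \<forall>j. \<omega> j \<in> X - A} = 0" for \<nu>
  proof (rule forever_null_if_bounded[of "1/2"])
    fix s assume s: "s \<in> X - A"
    have "measure (markov_law (P s) P) {\<omega>. \<forall>j. \<omega> j \<in> X - A}
        \<le> measure (markov_law (P s) P) (space (markov_law (P s) P) - {\<omega>. \<exists>j. \<omega> j \<in> A})"
      by (rule law.finite_measure_mono[OF _ sets.compl_sets[OF sets_visits]]) auto
    also have "\<dots> = 1 - measure (markov_law (P s) P) {\<omega>. \<exists>j. \<omega> j \<in> A}"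
      by (rule law.prob_compl[OF sets_visits])
    also have "\<dots> \<le> 1/2"
      using hit[of s] s by (simp add: hit_prob_def)
    finally show "measure (markov_law (P s) P) {\<omega>. \<forall>j. \<omega> j \<in> X - A} \<le> 1/2" .
  qed simp
  fix s assume s: "s \<in> X"
  \<comment> \<open>A path of \<open>\<phi>\<close> that stays in \<open>X\<close> visits
    \<open>A\<close> finitely often, so it settles in \<open>X - A\<close> from some time
    \<open>n\<close> on: a countable union of null events.\<close>
  have null: "(\<Union>n. {\<omega>. \<forall>j\<ge>n. \<omega> j \<in> X - A}) \<in> null_sets (markov_law (P s) P)"
  proof (rule null_sets_UN)
    show "{\<omega>. \<forall>j\<ge>n. \<omega> j \<in> X - A} \<in> null_sets (markov_law (P s) P)" for n :: nat
      using eventually_forever_null[OF XA, of "P s" n] sets_always[of n "X - A" "P s" P]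
      by (simp add: null_sets_def law.emeasure_eq_measure)
  qed
  have "{\<omega>. \<forall>j. \<omega> j \<in> X} \<subseteq> - \<phi> \<union> (\<Union>n. {\<omega>. \<forall>j\<ge>n. \<omega> j \<in> X - A})"
  proof (intro subsetI)
    fix \<omega> :: "nat \<Rightarrow> 's" assume \<omega>: "\<omega> \<in> {\<omega>. \<forall>j. \<omega> j \<in> X}"
    then have "\<omega> \<in> Fin_visits B"
      using B by (auto simp: mem_Fin_visits_iff)
    then have "\<omega> \<in> - \<phi> \<or> \<omega> \<in> Fin_visits A"
      using \<phi> by (auto simp: Inf_visits_eq)
    with \<omega> show "\<omega> \<in> - \<phi> \<union> (\<Union>n. {\<omega>. \<forall>j\<ge>n. \<omega> j \<in> X - A})"
      by (auto simp: mem_Fin_visits_iff)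
  qed
  then have "measure (markov_law (P s) P) {\<omega>. \<forall>j. \<omega> j \<in> X}
      \<le> measure (markov_law (P s) P) (- \<phi> \<union> (\<Union>n. {\<omega>. \<forall>j\<ge>n. \<omega> j \<in> X - A}))"
    using null by (intro law.finite_measure_mono) (auto intro!: sets_compl)
  also have "\<dots> = measure (markov_law (P s) P) (- \<phi>)"
    by (rule measure_Un_null_set[OF sets_compl null])
  also have "\<dots> \<le> c"
    by (rule c(2)[OF s])
  finally show "measure (markov_law (P s) P) {\<omega>. \<forall>j. \<omega> j \<in> X} \<le> c" .
qed

text \<open>The conditions for a single Streett pair; \<open>I\<close> is a parameter because all
  pairs share it.\<close>

definition pair_certificate ::
  "('s \<Rightarrow> 's pmf) \<Rightarrow> 's set \<Rightarrow> 's set \<Rightarrow> 's set \<Rightarrow> 's set \<Rightarrow> ('s \<Rightarrow> real) \<Rightarrow> ('s \<Rightarrow> real) \<Rightarrow> ('s \<Rightarrow> nat) \<Rightarrow> bool"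
where
  "pair_certificate P I A B J V W U \<longleftrightarrow>
      J \<subseteq> I - A \<and>
      (\<forall>s. 0 \<le> V s) \<and>
      (\<forall>s. 0 \<le> W s) \<and>
      (\<forall>s. s \<notin> A \<longrightarrow> pmf_apply (P s) V \<le> ennreal (V s)) \<and>
      (\<forall>s\<in>A. 1 \<le> V s) \<and>
      (\<exists>\<gamma>>0. \<forall>s\<in>J. V s \<le> 1 - \<gamma>) \<and>
      (\<forall>s\<in>I - (B \<union> J). pmf_apply (P s) W \<le> ennreal (W s) \<and> 0 < W s) \<and>
      (\<forall>s\<in>I \<inter> (B \<union> J). W s = 0 \<and> U s = 0) \<and>
      (\<forall>r\<ge>0. \<exists>\<epsilon>r>0. \<forall>s\<in>I - (B \<union> J).
          W s \<le> r \<longrightarrow> \<epsilon>r \<le> measure_pmf.prob (P s) {s'. U s' < U s}) \<and>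
      (\<forall>r\<ge>0. bdd_above (U ` {s \<in> I. W s \<le> r}))"

text \<open>\<open>V\<close> is the hitting probability of \<open>A\<close>. Outside
  \<open>B\<close> and \<open>J\<close> it exceeds 1/2, so \<open>X\<close> is left almost surely,
  and the exit lemmas supply \<open>W\<close> and \<open>U\<close>. Finite sublevel sets of
  \<open>W\<close> in \<open>X\<close> turn pointwise positivity into a uniform bound.\<close>

lemma streett_pair_certificate:
  fixes P :: "'s :: countable \<Rightarrow> 's pmf"
  assumes sets: "\<And>\<mu>. \<phi> \<in> sets (markov_law \<mu> P)"
    and \<phi>: "\<phi> \<subseteq> Fin_visits A \<union> Inf_visits B"
    and c: "c < 1" "\<And>s. s \<in> I \<Longrightarrow> measure (markov_law (P s) P) (- \<phi>) \<le> c"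
  shows "\<exists>J V W U. pair_certificate P I A B J V W U"
proof -
  \<comment> \<open>The threshold gives \<open>\<gamma> = 1/2\<close> and keeps \<open>J\<close>
    disjoint from \<open>A\<close>, where the hitting probability is 1.\<close>
  define J where "J = {s \<in> I. hit_prob P A s \<le> 1/2}"
  define X where "X = I - (B \<union> J)"
  have null: "measure (markov_law \<mu> P) {\<omega>. \<forall>j. \<omega> j \<in> X} = 0" for \<mu>
    by (rule streett_pair_forever_null[OF sets \<phi> c(1)]) (auto simp: X_def J_def c(2))
  obtain W where W: "\<And>s. s \<notin> X \<Longrightarrow> W s = 0" "\<And>s. s \<in> X \<Longrightarrow> 0 < W s"
    "\<And>s. s \<in> X \<Longrightarrow> (\<integral>\<^sup>+u. ennreal (W u) \<partial>measure_pmf (P s)) \<le> ennreal (W s)"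
    and fin: "\<And>r. finite {s \<in> X. W s \<le> r}"
    using exit_supermartingale[OF null] by metis
  obtain U :: "'s \<Rightarrow> nat" where U: "\<And>s. s \<notin> X \<Longrightarrow> U s = 0"
    "\<And>s. s \<in> X \<Longrightarrow> 0 < measure_pmf.prob (P s) {u. U u < U s}"
    using exit_distance[OF null] by metis
  have "0 \<le> W s" for s
    using W(1,2)[of s] by (cases "s \<in> X") auto
  moreover have "\<exists>\<epsilon>r>0. \<forall>s\<in>X. W s \<le> r \<longrightarrow> \<epsilon>r \<le> measure_pmf.prob (P s) {u. U u < U s}" for r
  proof -
    let ?p = "\<lambda>s. measure_pmf.prob (P s) {u. U u < U s}"
    \<comment> \<open>Adjoining 1 keeps the minimum meaningful when the sublevel set is
      empty.\<close>
    have "0 < Min (insert 1 (?p ` {s \<in> X. W s \<le> r}))"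
      using fin[of r] U(2) by (subst Min_gr_iff) auto
    moreover have "Min (insert 1 (?p ` {s \<in> X. W s \<le> r})) \<le> ?p s" if "s \<in> X" "W s \<le> r" for s
      using fin[of r] that by (intro Min_le) auto
    ultimately show ?thesis
      by blast
  qed
  moreover have "bdd_above (U ` {s \<in> I. W s \<le> r})" for r
  proof (rule bdd_above_mono)
    \<comment> \<open>The value 0 accounts for the states of \<open>I\<close> outside
      \<open>X\<close>.\<close>
    show "bdd_above (insert 0 (U ` {s \<in> X. W s \<le> r}))"
      using fin[of r] by (intro bdd_above_finite) auto
    show "U ` {s \<in> I. W s \<le> r} \<subseteq> insert 0 (U ` {s \<in> X. W s \<le> r})"
    proof (rule image_subsetI)
      fix s assume "s \<in> {s \<in> I. W s \<le> r}"
      then show "U s \<in> insert 0 (U ` {s \<in> X. W s \<le> r})"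
        using U(1)[of s] by (cases "s \<in> X") auto
    qed
  qed
  moreover have "\<exists>\<gamma>>0. \<forall>s\<in>J. hit_prob P A s \<le> 1 - \<gamma>"
    by (intro exI[of _ "1/2"]) (auto simp: J_def)
  moreover have "J \<subseteq> I - A"
    by (auto simp: J_def hit_prob_def)
  moreover have "\<forall>s. 0 \<le> hit_prob P A s" "\<forall>s\<in>A. 1 \<le> hit_prob P A s"
    by (simp_all add: hit_prob_def)
  moreover have "\<forall>s. s \<notin> A \<longrightarrow> pmf_apply (P s) (hit_prob P A) \<le> ennreal (hit_prob P A s)"
    by (simp add: pmf_apply_eq_nn_integral nn_integral_hit_prob) (simp add: hit_prob_def)
  moreover have "\<forall>s\<in>X. pmf_apply (P s) W \<le> ennreal (W s) \<and> 0 < W s"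
    by (simp add: pmf_apply_eq_nn_integral W)
  moreover have "\<forall>s\<in>I \<inter> (B \<union> J). W s = 0 \<and> U s = 0"
    by (auto simp: X_def intro!: W(1) U(1))
  ultimately have "pair_certificate P I A B J (hit_prob P A) W U"
    unfolding pair_certificate_def X_def[symmetric] by simp
  then show ?thesis
    by blast
qed

theorem theorem4p5:
  fixes \<mu> :: "'s :: countable pmf" and P :: "'s \<Rightarrow> 's pmf"
    and k :: nat and A B :: "nat \<Rightarrow> 's set" and p :: real
  assumes streett: "measure (markov_law \<mu> P)
      (\<Inter>i\<in>{1..k}. Fin_visits (A i) \<union> Inf_visits (B i)) = p"
    and p: "0 < p" "p \<le> 1"
  shows "\<forall>\<epsilon>>0. \<exists>(I :: 's set) (V0 :: 's \<Rightarrow> real) (J :: nat \<Rightarrow> 's set)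
      (V :: nat \<Rightarrow> 's \<Rightarrow> real) (W :: nat \<Rightarrow> 's \<Rightarrow> real) (U :: nat \<Rightarrow> 's \<Rightarrow> nat).
    (\<forall>s. 0 \<le> V0 s) \<and>
    pmf_apply \<mu> V0 \<le> ennreal (1 - p + \<epsilon>) \<and>
    (\<forall>i\<in>{1..k}.
      J i \<subseteq> I - A i \<and>
      (\<forall>s. 0 \<le> V i s) \<and>
      (\<forall>s. 0 \<le> W i s) \<and>
      (\<forall>s. s \<notin> A i \<longrightarrow> pmf_apply (P s) (V i) \<le> ennreal (V i s)) \<and>
      (\<forall>s\<in>A i. 1 \<le> V i s) \<and>
      (\<exists>\<gamma>>0. \<forall>s\<in>J i. V i s \<le> 1 - \<gamma>) \<and>
      (\<forall>s\<in>I - (B i \<union> J i). pmf_apply (P s) (W i) \<le> ennreal (W i s) \<and> 0 < W i s) \<and>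
      (\<forall>s\<in>I \<inter> (B i \<union> J i). W i s = 0 \<and> U i s = 0) \<and>
      (\<forall>r\<ge>0. \<exists>\<epsilon>r>0. \<forall>s\<in>I - (B i \<union> J i).
          W i s \<le> r \<longrightarrow> \<epsilon>r \<le> measure_pmf.prob (P s) {s'. U i s' < U i s}) \<and>
      (\<forall>r\<ge>0. bdd_above (U i ` {s \<in> I. W i s \<le> r}))) \<and>
    (\<forall>s\<in>I. pmf_apply (P s) V0 \<le> ennreal (V0 s)) \<and>
    (\<forall>s. s \<notin> I \<longrightarrow> 1 \<le> V0 s)"
proof (intro allI impI)
  fix \<epsilon> :: real assume \<epsilon>: "0 < \<epsilon>"
  define \<phi> where "\<phi> = (\<Inter>i\<in>{1..k}. Fin_visits (A i) \<union> Inf_visits (B i))"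
  have sets: "\<phi> \<in> sets (markov_law \<nu> P)" for \<nu>
    unfolding \<phi>_def
  proof (rule sets.countable_INT'')
    show "UNIV \<in> sets (markov_law \<nu> P)"
      using sets.top[of "markov_law \<nu> P"] by simp
  qed auto
  have sets_compl: "- \<phi> \<in> sets (markov_law \<nu> P)" for \<nu>
    using sets.compl_sets[OF sets, of \<nu>] by (simp add: Compl_eq_Diff_UNIV)
  define g where "g s = measure (markov_law (P s) P) (- \<phi>)" for s
  have tail: "case_nat s \<omega> \<in> - \<phi> \<longleftrightarrow> \<omega> \<in> - \<phi>" for s \<omega>
    by (simp add: \<phi>_def)
  \<comment> \<open>The initial law is arbitrary: \<open>P s\<close> shows that \<open>g\<close> is
    harmonic, and \<open>\<mu>\<close> evaluates the mean of \<open>V0\<close>.\<close>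
  have g: "(\<integral>\<^sup>+s. ennreal (g s) \<partial>measure_pmf \<nu>) = ennreal (measure (markov_law \<nu> P) (- \<phi>))" for \<nu>
    unfolding measure_markov_law_first_step[OF sets_compl] by (simp only: tail g_def Collect_mem_eq)
  \<comment> \<open>On \<open>I\<close> the failure probability is below
    \<open>1 / (1 + \<epsilon>)\<close>, which is the constant \<open>c < 1\<close> for every pair;
    off \<open>I\<close>, \<open>V0\<close> is at least 1.\<close>
  define I where "I = {s. (1 + \<epsilon>) * g s < 1}"
  define V0 where "V0 s = (1 + \<epsilon>) * g s" for s
  have V0: "pmf_apply \<nu> V0 = ennreal ((1 + \<epsilon>) * measure (markov_law \<nu> P) (- \<phi>))" for \<nu>
  proof -
    have "ennreal (V0 s) = ennreal (1 + \<epsilon>) * ennreal (g s)" for s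
      using \<epsilon> unfolding V0_def by (intro ennreal_mult) (auto simp: g_def)
    then have "pmf_apply \<nu> V0 = ennreal (1 + \<epsilon>) * ennreal (measure (markov_law \<nu> P) (- \<phi>))"
      by (simp only: pmf_apply_eq_nn_integral nn_integral_cmult borel_measurable_count_space
            measurable_pmf_measure1 g) (simp add: nn_integral_cmult g)
    then show ?thesis
      using \<epsilon> by (simp only: ennreal_mult measure_nonneg add_nonneg_nonneg less_imp_le zero_le_one)
  qed
  have "measure (markov_law \<mu> P) (- \<phi>) = 1 - p"
    using law.prob_compl[OF sets, of \<mu>] streett by (simp add: Compl_eq_Diff_UNIV \<phi>_def)
  \<comment> \<open>The two sides differ by \<open>\<epsilon> * p\<close>.\<close>
  moreover have "(1 + \<epsilon>) * (1 - p) \<le> 1 - p + \<epsilon>"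
    using p \<epsilon> by (simp add: algebra_simps)
  ultimately have \<mu>V0: "pmf_apply \<mu> V0 \<le> ennreal (1 - p + \<epsilon>)"
    by (simp add: V0 ennreal_leI)
  have "\<forall>i\<in>{1..k}. \<exists>J V W U. pair_certificate P I (A i) (B i) J V W U"
  proof
    fix i assume "i \<in> {1..k}"
    then have "\<phi> \<subseteq> Fin_visits (A i) \<union> Inf_visits (B i)"
      by (auto simp: \<phi>_def)
    moreover have "1 / (1 + \<epsilon>) < 1"
      using \<epsilon> by simp
    moreover have "measure (markov_law (P s) P) (- \<phi>) \<le> 1 / (1 + \<epsilon>)" if "s \<in> I" for s
      using that \<epsilon> by (simp add: I_def g_def field_simps)
    ultimately show "\<exists>J V W U. pair_certificate P I (A i) (B i) J V W U"
      by (rule streett_pair_certificate[OF sets])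
  qed
  then obtain J V W U
    where pairs: "\<And>i. i \<in> {1..k} \<Longrightarrow> pair_certificate P I (A i) (B i) (J i) (V i) (W i) (U i)"
    by metis
  have V0_nonneg: "\<forall>s. 0 \<le> V0 s"
    using \<epsilon> by (simp add: V0_def g_def)
  have V0_super: "\<forall>s\<in>I. pmf_apply (P s) V0 \<le> ennreal (V0 s)"
    unfolding V0 by (simp add: V0_def g_def)
  have V0_ge_1: "\<forall>s. s \<notin> I \<longrightarrow> 1 \<le> V0 s"
    by (simp add: I_def V0_def)
  show "\<exists>(I :: 's set) (V0 :: 's \<Rightarrow> real) (J :: nat \<Rightarrow> 's set)
      (V :: nat \<Rightarrow> 's \<Rightarrow> real) (W :: nat \<Rightarrow> 's \<Rightarrow> real) (U :: nat \<Rightarrow> 's \<Rightarrow> nat).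
    (\<forall>s. 0 \<le> V0 s) \<and>
    pmf_apply \<mu> V0 \<le> ennreal (1 - p + \<epsilon>) \<and>
    (\<forall>i\<in>{1..k}.
      J i \<subseteq> I - A i \<and>
      (\<forall>s. 0 \<le> V i s) \<and>
      (\<forall>s. 0 \<le> W i s) \<and>
      (\<forall>s. s \<notin> A i \<longrightarrow> pmf_apply (P s) (V i) \<le> ennreal (V i s)) \<and>
      (\<forall>s\<in>A i. 1 \<le> V i s) \<and>
      (\<exists>\<gamma>>0. \<forall>s\<in>J i. V i s \<le> 1 - \<gamma>) \<and>
      (\<forall>s\<in>I - (B i \<union> J i). pmf_apply (P s) (W i) \<le> ennreal (W i s) \<and> 0 < W i s) \<and>
      (\<forall>s\<in>I \<inter> (B i \<union> J i). W i s = 0 \<and> U i s = 0) \<and>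
      (\<forall>r\<ge>0. \<exists>\<epsilon>r>0. \<forall>s\<in>I - (B i \<union> J i).
          W i s \<le> r \<longrightarrow> \<epsilon>r \<le> measure_pmf.prob (P s) {s'. U i s' < U i s}) \<and>
      (\<forall>r\<ge>0. bdd_above (U i ` {s \<in> I. W i s \<le> r}))) \<and>
    (\<forall>s\<in>I. pmf_apply (P s) V0 \<le> ennreal (V0 s)) \<and>
    (\<forall>s. s \<notin> I \<longrightarrow> 1 \<le> V0 s)"
    by (rule exI[of _ I], rule exI[of _ V0], rule exI[of _ J], rule exI[of _ V], rule exI[of _ W],
        rule exI[of _ U], intro conjI ballI V0_nonneg \<mu>V0 V0_super V0_ge_1)
       (use pairs in \<open>simp_all add: pair_certificate_def\<close>)
qed

end
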